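(* Let $\beta,\psi_0$ be real constants, $\kappa>0$, $K\neq0$, and $I=\{r>0: r>K\}$. Set $\tilde{\mathcal{C}}\equiv0$, $\mathcal{V}\equiv0$, $\mathcal{A}(\psi)=-\frac{\beta}{8}\psi^2$, and $$A(r)=1-\frac{K}{r},\qquad C(r)=1,\qquad \psi(r)=-\frac{2\psi_0\sqrt r}{K\sqrt{r-K}} .$$ Then $E^{(1)}_{tt}=E^{(1)}_{rr}=E^{(1)}_{\vartheta\vartheta}=E^{(1)}_{\psi}=0$ hold on $I$. Thus the (asymptotically flat, extremal-Reissner–Nordström-type) metric ${\rm d}s^2=(1-\frac Kr)^2{\rm d}t^2-(1-\frac Kr)^{-2}{\rm d}r^2-r^2{\rm d}\Omega^2$ carries this non-trivial scalar field as a solution of the real-tetrad vacuum field equations.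
   Context: Metric ansatz ${\rm d}s^2=A(r)^2{\rm d}t^2-\frac{C(r)^2}{A(r)^2}{\rm d}r^2-r^2{\rm d}\Omega^2$, $\psi=\psi(r)$. Primes on $A,C,\psi$ are $r$-derivatives; $\mathcal{A}',\tilde{\mathcal{C}}',\tilde{\mathcal{C}}'',\mathcal{V}'$ are $\psi$-derivatives evaluated at $\psi(r)$. The real-tetrad reduced vacuum field equations of the scalar-torsion theory are: $E^{(1)}_{tt}:\ 0=\mathcal{A}\frac{A^2(-2rACA'-A^2(C-2rC')+C^3)}{r^2C^3}+\tilde{\mathcal{C}}'\Big(\frac{A^4\psi''}{C^2}-\frac{A^3\psi'(-rCA'+rAC'-2C^2)}{rC^3}\Big)-\frac{2A^3(A-C)\psi'\mathcal{A}'}{rC^2}+\frac{A^4\psi'^2\tilde{\mathcal{C}}''}{C^2}-\frac{\beta A^4\psi'^2}{2C^2}+\kappa^2A^2\mathcal{V}$; $E^{(1)}_{rr}:\ 0=-\frac{(2rAA'+A^2-C^2)\mathcal{A}}{r^2A^2}+\big(\frac{A'}{A}+\frac2r\big)\psi'\tilde{\mathcal{C}}'+\frac{\kappa^2C^2\mathcal{V}}{A^2}+\frac12\beta\psi'^2$; $E^{(1)}_{\vartheta\vartheta}:\ 0=-\frac{A\psi'(rA'+A-C)\mathcal{A}'}{rC^2}+\tilde{\mathcal{C}}'\Big(\frac{A\psi'(rCA'-rAC'+C^2)}{rC^3}+\frac{A^2\psi''}{C^2}\Big)+\frac{\mathcal{A}(-rCA'^2+A(rA'C'-C(rA''+2A'))+A^2C')}{rC^3}+\frac{A^2\psi'^2\tilde{\mathcal{C}}''}{C^2}-\frac{\beta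 A^2\psi'^2}{2C^2}+\kappa^2\mathcal{V}$; $E^{(1)}_{\psi}:\ 0=\frac{(A-C)(2rA'+A-C)\mathcal{A}'}{r^2C^2}+\frac{\beta A\psi'(2rCA'+A(2C-rC'))}{rC^3}+\frac{\beta A^2\psi''}{C^2}+\kappa^2\mathcal{V}'+\frac{\tilde{\mathcal{C}}'(rCA'(rA'-2C)+A(-r^2A'C'+rC(rA''+6A')-2C^2)+2A^2(C-rC'))}{r^2C^3}$. *)

theory Defs
  imports "HOL-Analysis.Analysis"
begin

text \<open>Arguments:
  A, C, psi : functions of r (primes = r-derivatives, via deriv);
  calA, tC, V : functions of psi (the coupling functions \<A>, \<C>~, \<V>;
  their primes are psi-derivatives evaluated at psi r).
  Each E_xx returns the right-hand side of  0 = ... at radius r.\<close>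

definition E_tt :: "(real\<Rightarrow>real) \<Rightarrow> (real\<Rightarrow>real) \<Rightarrow> (real\<Rightarrow>real) \<Rightarrow>
    (real\<Rightarrow>real) \<Rightarrow> (real\<Rightarrow>real) \<Rightarrow> (real\<Rightarrow>real) \<Rightarrow> real \<Rightarrow> real \<Rightarrow> real \<Rightarrow> real" where
  "E_tt A C psi calA tC V beta kap r =
    (let a = A r; a1 = deriv A r; c = C r; c1 = deriv C r;
         p = psi r; p1 = deriv psi r; p2 = deriv (deriv psi) r;
         cA = calA p; cA1 = deriv calA p; tC1 = deriv tC p; tC2 = deriv (deriv tC) p; pV = V p
     in cA * (a^2 * (- 2*r*a*c*a1 - a^2*(c - 2*r*c1) + c^3)) / (r^2 * c^3)
        + tC1 * (a^4*p2 / c^2 - a^3*p1*(- r*c*a1 + r*a*c1 - 2*c^2) / (r*c^3))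
        - 2*a^3*(a - c)*p1*cA1 / (r*c^2)
        + a^4*p1^2*tC2 / c^2
        - beta*a^4*p1^2 / (2*c^2)
        + kap^2*a^2 * pV)"

definition E_rr :: "(real\<Rightarrow>real) \<Rightarrow> (real\<Rightarrow>real) \<Rightarrow> (real\<Rightarrow>real) \<Rightarrow>
    (real\<Rightarrow>real) \<Rightarrow> (real\<Rightarrow>real) \<Rightarrow> (real\<Rightarrow>real) \<Rightarrow> real \<Rightarrow> real \<Rightarrow> real \<Rightarrow> real" where
  "E_rr A C psi calA tC V beta kap r =
    (let a = A r; a1 = deriv A r; c = C r;
         p = psi r; p1 = deriv psi r;
         cA = calA p; tC1 = deriv tC p; pV = V p
     in - ((2*r*a*a1 + a^2 - c^2) * cA) / (r^2 * a^2)
        + (a1/a + 2/r) * p1 * tC1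
        + kap^2*c^2 * pV / a^2
        + beta*p1^2 / 2)"

definition E_thth :: "(real\<Rightarrow>real) \<Rightarrow> (real\<Rightarrow>real) \<Rightarrow> (real\<Rightarrow>real) \<Rightarrow>
    (real\<Rightarrow>real) \<Rightarrow> (real\<Rightarrow>real) \<Rightarrow> (real\<Rightarrow>real) \<Rightarrow> real \<Rightarrow> real \<Rightarrow> real \<Rightarrow> real" where
  "E_thth A C psi calA tC V beta kap r =
    (let a = A r; a1 = deriv A r; a2 = deriv (deriv A) r; c = C r; c1 = deriv C r;
         p = psi r; p1 = deriv psi r; p2 = deriv (deriv psi) r;
         cA = calA p; cA1 = deriv calA p; tC1 = deriv tC p; tC2 = deriv (deriv tC) p; pV = V p
     in - (a*p1*(r*a1 + a - c)*cA1) / (r*c^2)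
        + tC1 * (a*p1*(r*c*a1 - r*a*c1 + c^2) / (r*c^3) + a^2*p2 / c^2)
        + cA * (- r*c*a1^2 + a*(r*a1*c1 - c*(r*a2 + 2*a1)) + a^2*c1) / (r*c^3)
        + a^2*p1^2*tC2 / c^2
        - beta*a^2*p1^2 / (2*c^2)
        + kap^2 * pV)"

definition E_psi :: "(real\<Rightarrow>real) \<Rightarrow> (real\<Rightarrow>real) \<Rightarrow> (real\<Rightarrow>real) \<Rightarrow>
    (real\<Rightarrow>real) \<Rightarrow> (real\<Rightarrow>real) \<Rightarrow> (real\<Rightarrow>real) \<Rightarrow> real \<Rightarrow> real \<Rightarrow> real \<Rightarrow> real" where
  "E_psi A C psi calA tC V beta kap r =
    (let a = A r; a1 = deriv A r; a2 = deriv (deriv A) r; c = C r; c1 = deriv C r;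
         p = psi r; p1 = deriv psi r; p2 = deriv (deriv psi) r;
         cA1 = deriv calA p; tC1 = deriv tC p; dV = deriv V p
     in (a - c)*(2*r*a1 + a - c)*cA1 / (r^2*c^2)
        + beta*a*p1*(2*r*c*a1 + a*(2*c - r*c1)) / (r*c^3)
        + beta*a^2*p2 / c^2
        + kap^2 * dV
        + tC1 * (r*c*a1*(r*a1 - 2*c) + a*(- (r^2*a1*c1) + r*c*(r*a2 + 6*a1) - 2*c^2)
                 + 2*a^2*(c - r*c1)) / (r^2*c^3))"

end

theory Submission
  imports Defs
begin

text \<open>With \<open>\<C>~ = \<V> = 0\<close> and \<open>C = 1\<close> the field equations involve only \<open>A, A', A''\<close>
  and \<open>\<psi>, \<psi>', \<psi>''\<close>. Computing these derivatives explicitly and writing \<open>r = s\<^sup>2\<close>,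
  \<open>r - K = w\<^sup>2\<close> with \<open>s = \<surd>r\<close>, \<open>w = \<surd>(r - K)\<close> turns every equation into a rational
  identity in \<open>s, w\<close>, which holds because the \<open>\<A>\<close>-terms, quadratic in \<open>\<psi>\<close>, cancel
  exactly against the kinetic \<open>\<beta>\<close>-terms.\<close>

lemma deriv_deriv_eq_on_open:
  fixes f :: "real \<Rightarrow> real"
  assumes "open S" "x \<in> S"
    and "\<And>y. y \<in> S \<Longrightarrow> (f has_real_derivative f' y) (at y)"
    and "(f' has_real_derivative f'') (at x)"
  shows "deriv (deriv f) x = f''"
proof -
  have "eventually (\<lambda>y. deriv f y = f' y) (nhds x)"
    using eventually_nhds_in_open[OF assms(1,2)]
    by (rule eventually_mono) (use assms(3) DERIV_imp_deriv in blast)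
  then have "deriv (deriv f) x = deriv f' x"
    by (rule deriv_cong_ev) simp
  also have "\<dots> = f''"
    using assms(4) by (rule DERIV_imp_deriv)
  finally show ?thesis .
qed

lemma lapse_has_derivative:
  fixes K r :: real
  assumes "r \<noteq> 0"
  shows "((\<lambda>r. 1 - K / r) has_real_derivative K / r^2) (at r)"
  using assms by (auto intro!: derivative_eq_intros simp: power2_eq_square)

lemma lapse_derivs:
  fixes K r :: real
  assumes "r \<noteq> 0"
  shows "deriv (\<lambda>r. 1 - K / r) r = K / r^2"
    and "deriv (deriv (\<lambda>r. 1 - K / r)) r = - 2 * K / r^3"
proof -
  show "deriv (\<lambda>r. 1 - K / r) r = K / r^2"
    using lapse_has_derivative[OF assms] by (rule DERIV_imp_deriv)
  have "((\<lambda>r. K / r^2) has_real_derivative - 2 * K / r^3) (at r)"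
    using assms by (auto intro!: derivative_eq_intros simp: field_simps power2_eq_square power3_eq_cube)
  then show "deriv (deriv (\<lambda>r. 1 - K / r)) r = - 2 * K / r^3"
    using assms lapse_has_derivative
    by (intro deriv_deriv_eq_on_open[of "- {0}"]) auto
qed

lemma scalar_profile_has_derivative:
  fixes K c r :: real
  assumes "r > 0" "r > K" "K \<noteq> 0"
  shows "((\<lambda>r. - (2 * c * sqrt r) / (K * sqrt (r - K))) has_real_derivative
          c / (sqrt r * (r - K) * sqrt (r - K))) (at r)"
proof -
  have "sqrt r > 0" "sqrt (r - K) > 0"
    using assms by auto
  then show ?thesis
    using assms by (auto intro!: derivative_eq_intros) (simp add: field_simps)
qed

lemma scalar_profile_derivative_has_derivative:
  fixes K c r :: real
  assumes "r > 0" "r > K"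
  shows "((\<lambda>r. c / (sqrt r * (r - K) * sqrt (r - K))) has_real_derivative
          - c * (4 * r - K) / (2 * sqrt r * r * (r - K)^2 * sqrt (r - K))) (at r)"
proof -
  obtain s w where s: "s = sqrt r" "s > 0" and w: "w = sqrt (r - K)" "w > 0"
    using assms by auto
  have r: "r = s * s" and K: "K = s * s - w * w"
    using s w assms by auto
  show ?thesis
    using assms s w
    by (auto intro!: derivative_eq_intros simp flip: s(1) w(1))
       (unfold r K, simp add: field_simps power2_eq_square)
qed

lemma scalar_profile_derivs:
  fixes K c r :: real
  assumes "r > 0" "r > K" "K \<noteq> 0"
  defines "psi \<equiv> \<lambda>r. - (2 * c * sqrt r) / (K * sqrt (r - K))"
  shows "deriv psi r = c / (sqrt r * (r - K) * sqrt (r - K))"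
    and "deriv (deriv psi) r = - c * (4 * r - K) / (2 * sqrt r * r * (r - K)^2 * sqrt (r - K))"
proof -
  show "deriv psi r = c / (sqrt r * (r - K) * sqrt (r - K))"
    unfolding psi_def using assms by (intro DERIV_imp_deriv scalar_profile_has_derivative)
  show "deriv (deriv psi) r = - c * (4 * r - K) / (2 * sqrt r * r * (r - K)^2 * sqrt (r - K))"
    unfolding psi_def using assms
    by (intro deriv_deriv_eq_on_open[of "{0<..} \<inter> {K<..}" _ _
          "\<lambda>r. c / (sqrt r * (r - K) * sqrt (r - K))"]
          scalar_profile_has_derivative scalar_profile_derivative_has_derivative) auto
qed

theorem mainTheorem4:
  fixes beta psi0 kap K :: real
  assumes "kap > 0" and "K \<noteq> 0"
  defines "A \<equiv> (\<lambda>r::real. 1 - K / r)"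
      and "C \<equiv> (\<lambda>r::real. 1::real)"
      and "psi \<equiv> (\<lambda>r::real. - (2 * psi0 * sqrt r) / (K * sqrt (r - K)))"
      and "calA \<equiv> (\<lambda>p::real. - (beta / 8) * p^2)"
      and "tC \<equiv> (\<lambda>p::real. 0::real)"
      and "V \<equiv> (\<lambda>p::real. 0::real)"
  shows "\<forall>r \<in> {r::real. r > 0 \<and> r > K}.
           E_tt A C psi calA tC V beta kap r = 0 \<and>
           E_rr A C psi calA tC V beta kap r = 0 \<and>
           E_thth A C psi calA tC V beta kap r = 0 \<and>
           E_psi A C psi calA tC V beta kap r = 0"
proof
  fix r assume "r \<in> {r::real. r > 0 \<and> r > K}"
  then have r: "r > 0" "r > K" and "r \<noteq> 0" by auto
  have dcalA: "deriv calA p = - (beta / 4) * p" for p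
    unfolding calA_def by (intro DERIV_imp_deriv) (auto intro!: derivative_eq_intros)
  have dconst: "deriv C = (\<lambda>_. 0)" "deriv tC = (\<lambda>_. 0)" "deriv V = (\<lambda>_. 0)"
    unfolding C_def tC_def V_def by auto
  note derivs = dcalA dconst lapse_derivs[of r K, OF \<open>r \<noteq> 0\<close>, folded A_def]
    scalar_profile_derivs[where c = psi0, OF r assms(2), folded psi_def]
  obtain s w where s: "sqrt r = s" "s > 0" and w: "sqrt (r - K) = w" "w > 0"
    using r by auto
  have rs: "r = s * s" and rKw: "r - K = w * w"
    using r by (auto simp flip: s(1) w(1))
  then have K: "K = s * s - w * w" by simp
  have lapse: "1 - K / (s * s) = w * w / (s * s)"
    using K s by (simp add: field_simps)
  show "E_tt A C psi calA tC V beta kap r = 0 \<and> E_rr A C psi calA tC V beta kap r = 0 \<and>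
      E_thth A C psi calA tC V beta kap r = 0 \<and> E_psi A C psi calA tC V beta kap r = 0"
    unfolding E_tt_def E_rr_def E_thth_def E_psi_def Let_def derivs
    unfolding A_def C_def psi_def calA_def tC_def V_def s(1) w(1)
    unfolding rKw unfolding rs lapse
    using s(2) w(2) assms(2)
    by (intro conjI; simp add: field_simps power2_eq_square power3_eq_cube; unfold K; algebra)
qed

end
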